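(* Let $m,n,r\ge1$ be integers, $M\in\mathbb{R}^{m\times n}$, and let $f:\mathbb{R}^{m\times r}\times\mathbb{R}^{r\times n}\to\mathbb{R}$ be defined by $f(X,Y)=\|XY-M\|_F^2/2$. Suppose $(\overline X,\overline Y)\in\mathbb{R}^{m\times r}\times\mathbb{R}^{r\times n}$ satisfies $\overline X\,\overline Y=M$. The following are equivalent: (i) $(\overline X,\overline Y)$ is globally flat; (ii) $(\overline X,\overline Y)$ is flat; (iii) $(\overline X,\overline Y)$ is a local minimum of $\lambda_1(\nabla^2f(X,Y))$ over $\{(X,Y):XY=M\}$; (iv) $\|\overline X\|_2=\|\overline Y\|_2$ and there exists $(\overline H,\overline K)\in E_1(\nabla^2f(\overline X,\overline Y))\setminus\{0\}$ such that $\overline H^T\overline H=\overline K\,\overline K^T$; (v) $(\overline X,\overline Y)$ is a global minimum of $\lambda_1(\nabla^2f(X,Y))$ over $\{(X,Y):XY=M\}$; (vi) $\|\overline X\|_2^2+\|\overline Y\|_2^2=2\|M\|_2$; (vii) $\|\overline X\|_2=\|\overline Y\|_2=\sqrt{\|M\|_2}$.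
   Context: $\|\cdot\|_F$ is the Frobenius norm and $\|\cdot\|_2$ the spectral norm. The space $\mathbb{R}^{m\times r}\times\mathbb{R}^{r\times n}$ carries the Euclidean norm $\sqrt{\|H\|_F^2+\|K\|_F^2}$. For a symmetric matrix (or operator) $A$, $\lambda_1(A)$ is its largest eigenvalue and $E_1(A)$ the associated eigenspace; elements of $E_1(\nabla^2f(\overline X,\overline Y))$ are identified with pairs $(H,K)\in\mathbb{R}^{m\times r}\times\mathbb{R}^{r\times n}$. Flatness of a function $f$ on a Euclidean space: let $\mathring f(x,\rho)=\sup_{y\in\overline B_\rho(x)}|f(y)-f(x)|$ with $\overline B_\rho(x)$ the closed ball, and write $x\preceq y$ iff there exists $\overline\rho>0$ such that $\mathring f(x,\rho)\le\mathring f(y,\rho)$ for all $\rho\in(0,\overline\rho]$. A point $\overline x$ is flat if there is a neighborhood $U$ of $\overline x$ in the level set $\{x:f(x)=f(\overline x)\}$ such that $\overline x\preceq x$ for all $x\in U\setminus\{\overline x\}$; it is globally flat if $\overline x\preceq x$ for all $x$ with $f(x)=f(\overline x)$. *)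

theory Defs
  imports "HOL-Analysis.Analysis"
begin

text \<open>
  Matrices are elements of \<open>real^'n^'m\<close> (rows indexed by \<open>'m\<close>). The instance norm on this type is the
  Euclidean norm of all entries, i.e. the Frobenius norm, and the norm on the product type is
  \<open>sqrt ((norm H)\<^sup>2 + (norm K)\<^sup>2)\<close>.
\<close>

definition spectral_norm :: "real^'n^'m \<Rightarrow> real"
  where "spectral_norm A = onorm (\<lambda>x. A *v x)"

definition factorization_loss :: "real^'n^'m \<Rightarrow> (real^'r^'m) \<times> (real^'n^'r) \<Rightarrow> real"
  where "factorization_loss M = (\<lambda>(X, Y). (norm (X ** Y - M))\<^sup>2 / 2)"

definition factorizations :: "real^'n^'m \<Rightarrow> ((real^'r^'m) \<times> (real^'n^'r)) set"
  where "factorizations M = {(X, Y). X ** Y = M}"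


subsection \<open>Gradient, Hessian, and extremal eigenpairs\<close>

definition gradient :: "('a::euclidean_space \<Rightarrow> real) \<Rightarrow> 'a \<Rightarrow> 'a"
  where "gradient f x = (THE D. GDERIV f x :> D)"

text \<open>The Hessian is the self-adjoint operator given by the derivative of the gradient.\<close>

definition hessian :: "('a::euclidean_space \<Rightarrow> real) \<Rightarrow> 'a \<Rightarrow> 'a \<Rightarrow> 'a"
  where "hessian f x = frechet_derivative (gradient f) (at x)"

definition is_eigenvalue :: "('a::euclidean_space \<Rightarrow> 'a) \<Rightarrow> real \<Rightarrow> bool"
  where "is_eigenvalue A c \<longleftrightarrow> (\<exists>v. v \<noteq> 0 \<and> A v = c *\<^sub>R v)"

text \<open>Meaningful for self-adjoint linear \<open>A\<close>, for which a largest eigenvalue exists.\<close>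

definition largest_eigenvalue :: "('a::euclidean_space \<Rightarrow> 'a) \<Rightarrow> real"
  where "largest_eigenvalue A = (GREATEST c. is_eigenvalue A c)"

definition top_eigenspace :: "('a::euclidean_space \<Rightarrow> 'a) \<Rightarrow> 'a set"
  where "top_eigenspace A = {v. A v = largest_eigenvalue A *\<^sub>R v}"


subsection \<open>Constrained minima\<close>

definition global_min_on :: "('a \<Rightarrow> real) \<Rightarrow> 'a set \<Rightarrow> 'a \<Rightarrow> bool"
  where "global_min_on g S x \<longleftrightarrow> is_arg_min g (\<lambda>y. y \<in> S) x"

definition local_min_on :: "('a::topological_space \<Rightarrow> real) \<Rightarrow> 'a set \<Rightarrow> 'a \<Rightarrow> bool"
  where "local_min_on g S x \<longleftrightarrow> (\<exists>U. open U \<and> x \<in> U \<and> is_arg_min g (\<lambda>y. y \<in> S \<inter> U) x)"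


subsection \<open>Flatness\<close>

text \<open>The supremum is taken in \<^typ>\<open>ereal\<close> so that it is also correct for functions unbounded on balls.\<close>

definition max_variation :: "('a::euclidean_space \<Rightarrow> real) \<Rightarrow> 'a \<Rightarrow> real \<Rightarrow> ereal"
  where "max_variation f x \<rho> = (SUP y\<in>cball x \<rho>. ereal \<bar>f y - f x\<bar>)"

definition flatter_eq :: "('a::euclidean_space \<Rightarrow> real) \<Rightarrow> 'a \<Rightarrow> 'a \<Rightarrow> bool"
  where "flatter_eq f x y \<longleftrightarrow>
    (\<exists>\<rho>0>0. \<forall>\<rho>\<in>{0<..\<rho>0}. max_variation f x \<rho> \<le> max_variation f y \<rho>)"

definition level_set :: "('a \<Rightarrow> real) \<Rightarrow> 'a \<Rightarrow> 'a set"
  where "level_set f x = {y. f y = f x}"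

definition flat :: "('a::euclidean_space \<Rightarrow> real) \<Rightarrow> 'a \<Rightarrow> bool"
  where "flat f x \<longleftrightarrow>
    (\<exists>U. openin (top_of_set (level_set f x)) U \<and> x \<in> U \<and> (\<forall>y\<in>U - {x}. flatter_eq f x y))"

definition globally_flat :: "('a::euclidean_space \<Rightarrow> real) \<Rightarrow> 'a \<Rightarrow> bool"
  where "globally_flat f x \<longleftrightarrow> (\<forall>y\<in>level_set f x. flatter_eq f x y)"

end

theory Submission
  imports Defs
begin

text \<open>
  At a factorization \<open>X Y = M\<close> the Hessian is \<open>L\<^sup>* L\<close> with \<open>L (H, K) = X K + H Y\<close>, and \<open>L L\<^sup>*\<close> maps \<open>Z\<close> to
  \<open>X X\<^sup>T Z + Z Y\<^sup>T Y\<close>, so the largest eigenvalue is \<open>l\<^sup>2 = \<parallel>X\<parallel>\<^sub>2\<^sup>2 + \<parallel>Y\<parallel>\<^sub>2\<^sup>2 \<ge> 2 \<parallel>M\<parallel>\<^sub>2\<close>. The maximal variation of the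
  loss on a ball of radius \<open>\<rho>\<close> lies between \<open>(l \<rho> - \<rho>\<^sup>2 / 2)\<^sup>2 / 2\<close> and \<open>(l \<rho> + \<rho>\<^sup>2 / 2)\<^sup>2 / 2\<close>, so flatness forces a
  minimal \<open>l\<close>. Ties between factorizations with \<open>l\<^sup>2 = 2 \<parallel>M\<parallel>\<^sub>2\<close> are harmless: all of them attain the upper
  bound, through common top singular vectors of \<open>X\<close>, \<open>Y\<close> and \<open>M\<close>.

  A local minimum of \<open>l\<close> satisfies \<open>\<parallel>X\<parallel>\<^sub>2 = \<parallel>Y\<parallel>\<^sub>2 = s\<close> by rescaling, and moving along
  \<open>(X (I + t S), (I + t S)\<^sup>-\<^sup>1 Y)\<close> with \<open>S = Y Y\<^sup>T - X\<^sup>T X\<close> lowers both norms unless \<open>X\<^sup>T X\<close> and \<open>Y Y\<^sup>T\<close> share an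
  eigenvector for \<open>s\<^sup>2\<close>; such a vector shows \<open>\<parallel>M\<parallel>\<^sub>2 \<ge> s\<^sup>2\<close>.
\<close>

subsection \<open>Frobenius and spectral norms\<close>

text \<open>In finite dimension bilinearity gives boundedness. As a locale interpretation this
  supplies distributivity, scaling rules and the product rule for derivatives.\<close>

lemma bounded_bilinear_matrix_mult:
  "bounded_bilinear ((**) :: real^'n^'m \<Rightarrow> real^'k^'n \<Rightarrow> real^'k^'m)"
proof -
  have "linear (\<lambda>A :: real^'n^'m. A ** B)" for B :: "real^'k^'n"
    by (rule linearI)
      (simp_all add: matrix_matrix_mult_def vec_eq_iff distrib_right sum.distrib
        sum_distrib_left mult.assoc)
  moreover have "linear (\<lambda>B :: real^'k^'n. A ** B)" for A :: "real^'n^'m"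
    by (rule linearI)
      (simp_all add: matrix_matrix_mult_def vec_eq_iff distrib_left sum.distrib
        sum_distrib_left mult.left_commute)
  ultimately show ?thesis
    unfolding bilinear_conv_bounded_bilinear[symmetric] bilinear_def by blast
qed

interpretation matrix_mult: bounded_bilinear
  "(**) :: real^'n^'m \<Rightarrow> real^'k^'n \<Rightarrow> real^'k^'m"
  by (rule bounded_bilinear_matrix_mult)

section \<open>Adjoints under the Frobenius inner product\<close>

lemma inner_transpose_mult_vector:
  fixes A :: "real^'n^'m"
  shows "(A *v x) \<bullet> y = x \<bullet> (transpose A *v y)"
  by (metis dot_lmul_matrix inner_commute transpose_matrix_vector)

lemma transpose_add: "transpose (A + B) = transpose A + transpose (B :: real^'n^'m)"
  by (simp add: transpose_def vec_eq_iff)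

lemma inner_matrix_mult_left:
  fixes A :: "real^'n^'m" and B :: "real^'k^'n"
  shows "(A ** B) \<bullet> C = B \<bullet> (transpose A ** C)"
proof -
  have "(A ** B) \<bullet> C = (\<Sum>i\<in>UNIV. \<Sum>j\<in>UNIV. \<Sum>k\<in>UNIV. A$i$k * B$k$j * C$i$j)"
    by (simp add: inner_vec_def matrix_matrix_mult_def sum_distrib_right)
  also have "\<dots> = (\<Sum>j\<in>UNIV. \<Sum>k\<in>UNIV. \<Sum>i\<in>UNIV. A$i$k * B$k$j * C$i$j)"
    by (subst sum.swap, rule sum.cong[OF refl], rule sum.swap)
  also have "\<dots> = B \<bullet> (transpose A ** C)"
    by (subst sum.swap)
      (simp add: inner_vec_def matrix_matrix_mult_def transpose_def sum_distrib_left algebra_simps)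
  finally show ?thesis .
qed

lemma inner_transpose:
  fixes A B :: "real^'n^'m"
  shows "transpose A \<bullet> transpose B = A \<bullet> B"
  unfolding inner_vec_def transpose_def by simp (rule sum.swap)

lemma norm_transpose: "norm (transpose A) = norm (A :: real^'n^'m)"
  by (simp add: norm_eq_sqrt_inner inner_transpose)

lemma inner_matrix_mult_right:
  fixes A :: "real^'n^'m" and B :: "real^'k^'n"
  shows "(A ** B) \<bullet> C = A \<bullet> (C ** transpose B)"
proof -
  have "(A ** B) \<bullet> C = (transpose B ** transpose A) \<bullet> transpose C"
    by (simp add: inner_transpose flip: matrix_transpose_mul)
  also have "\<dots> = transpose A \<bullet> transpose (C ** transpose B)"
    by (simp add: inner_matrix_mult_left matrix_transpose_mul)
  finally show ?thesis by (simp add: inner_transpose)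
qed

section \<open>The spectral norm as an operator norm\<close>

lemma spectral_norm_nonneg: "0 \<le> spectral_norm A"
  unfolding spectral_norm_def
  by (rule onorm_pos_le) (rule matrix_vector_mul_bounded_linear)

lemma norm_mult_vector_le: "norm (A *v x) \<le> spectral_norm A * norm x"
  unfolding spectral_norm_def
  by (rule onorm) (rule matrix_vector_mul_bounded_linear)

lemma spectral_norm_le:
  assumes "\<And>x. norm (A *v x) \<le> b * norm x"
  shows "spectral_norm A \<le> b"
  unfolding spectral_norm_def using assms by (rule onorm_le)

text \<open>Compactness of the unit sphere gives a maximizer; homogeneity extends its bound to all
  vectors.\<close>

lemma spectral_norm_attained:
  fixes A :: "real^'n^'m"
  obtains v where "norm v = 1" "norm (A *v v) = spectral_norm A"
proof -
  let ?S = "sphere (0::real^'n) 1"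
  have "\<exists>v\<in>?S. \<forall>y\<in>?S. norm (A *v y) \<le> norm (A *v v)"
    by (rule continuous_attains_sup)
      (auto intro!: continuous_on_norm[OF linear_continuous_on[OF matrix_vector_mul_bounded_linear]])
  then obtain v where v: "norm v = 1" "\<And>y. norm y = 1 \<Longrightarrow> norm (A *v y) \<le> norm (A *v v)"
    by auto
  have "spectral_norm A \<le> norm (A *v v)"
  proof (rule spectral_norm_le)
    fix x
    show "norm (A *v x) \<le> norm (A *v v) * norm x"
    proof (cases "x = 0")
      case False
      have "norm (A *v x) / norm x = norm (A *v (x /\<^sub>R norm x))"
        by (simp add: matrix_vector_mult_scaleR divide_inverse mult.commute)
      also have "\<dots> \<le> norm (A *v v)"
        using False by (intro v) simp
      finally show ?thesis
        using False by (simp add: field_simps)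
    qed simp
  qed
  with norm_mult_vector_le[of A v] v that show ?thesis by simp
qed

text \<open>|B x|^2 = x . (B^T B x) \<le> |x| |B^T| |B x|; cancelling |B x| bounds B by its
  transpose, and the same bound for B^T gives equality.\<close>

lemma spectral_norm_transpose:
  fixes A :: "real^'n^'m"
  shows "spectral_norm (transpose A) = spectral_norm A"
proof -
  have le: "spectral_norm B \<le> spectral_norm (transpose B)" for B :: "real^'a^'b"
  proof (rule spectral_norm_le)
    fix x
    have "norm (B *v x) ^ 2 = x \<bullet> (transpose B *v (B *v x))"
      by (simp add: power2_norm_eq_inner inner_transpose_mult_vector del: transpose_matrix_vector)
    also have "\<dots> \<le> norm x * norm (transpose B *v (B *v x))"
      by (rule norm_cauchy_schwarz)
    also have "\<dots> \<le> norm x * (spectral_norm (transpose B) * norm (B *v x))"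
      by (intro mult_left_mono norm_mult_vector_le) simp
    finally have "norm (B *v x) * norm (B *v x) \<le> (spectral_norm (transpose B) * norm x) * norm (B *v x)"
      by (simp add: power2_eq_square mult_ac)
    then show "norm (B *v x) \<le> spectral_norm (transpose B) * norm x"
      by (cases "B *v x = 0") (auto simp: spectral_norm_nonneg)
  qed
  from le[of A] le[of "transpose A"] show ?thesis by simp
qed

lemma spectral_norm_mult_le: "spectral_norm (A ** B) \<le> spectral_norm A * spectral_norm B"
proof (rule spectral_norm_le)
  fix x
  have "norm ((A ** B) *v x) \<le> spectral_norm A * norm (B *v x)"
    by (simp add: norm_mult_vector_le flip: matrix_vector_mul_assoc)
  also have "\<dots> \<le> spectral_norm A * (spectral_norm B * norm x)"
    by (intro mult_left_mono norm_mult_vector_le spectral_norm_nonneg)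
  finally show "norm ((A ** B) *v x) \<le> spectral_norm A * spectral_norm B * norm x"
    by (simp add: mult_ac)
qed

lemma spectral_norm_scaleR: "spectral_norm (c *\<^sub>R A) = \<bar>c\<bar> * spectral_norm A"
  unfolding spectral_norm_def scaleR_matrix_vector_assoc[symmetric]
  by (rule onorm_scaleR) (rule matrix_vector_mul_bounded_linear)

lemma spectral_norm_eq_0: "spectral_norm A = 0 \<longleftrightarrow> A = 0"
proof
  assume "spectral_norm A = 0"
  then have "A *v x = 0 *v x" for x
    using norm_mult_vector_le[of A x] by simp
  then show "A = 0" by (simp add: matrix_eq)
qed (simp add: spectral_norm_def onorm_zero)

text \<open>Row i of A B is B^T applied to row i of A, and the squared Frobenius norm splits over
  rows.\<close>

lemma norm_matrix_mult_le_spectral_norm_right: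
  fixes A :: "real^'n^'m" and B :: "real^'k^'n"
  shows "norm (A ** B) \<le> norm A * spectral_norm B"
proof -
  have "norm (A ** B) ^ 2 = (\<Sum>i\<in>UNIV. norm (transpose B *v (A $ i)) ^ 2)"
    unfolding power2_norm_eq_inner
    by (simp add: inner_vec_def matrix_matrix_mult_def vector_matrix_mult_def mult.commute)
  also have "\<dots> \<le> (\<Sum>i\<in>UNIV. (spectral_norm B * norm (A $ i)) ^ 2)"
    using norm_mult_vector_le[of "transpose B"]
    by (intro sum_mono power_mono) (auto simp: spectral_norm_transpose simp del: transpose_matrix_vector)
  also have "\<dots> = (norm A * spectral_norm B) ^ 2"
    by (simp add: norm_vec_def L2_set_def power_mult_distrib sum_nonneg sum_distrib_left mult_ac)
  finally show ?thesis
    by (rule power2_le_imp_le) (simp add: spectral_norm_nonneg)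
qed

lemma norm_matrix_mult_le_spectral_norm_left:
  fixes A :: "real^'n^'m" and B :: "real^'k^'n"
  shows "norm (A ** B) \<le> spectral_norm A * norm B"
  using norm_matrix_mult_le_spectral_norm_right[of "transpose B" "transpose A"]
  by (simp add: norm_transpose spectral_norm_transpose mult.commute flip: matrix_transpose_mul)

lemma spectral_norm_le_norm: "spectral_norm A \<le> norm (A :: real^'n^'m)"
proof (rule spectral_norm_le)
  fix x
  have "norm (A *v x) ^ 2 = (\<Sum>i\<in>UNIV. (A $ i \<bullet> x) ^ 2)"
    by (simp add: norm_vec_def L2_set_def sum_nonneg matrix_mult_dot)
  also have "\<dots> \<le> (\<Sum>i\<in>UNIV. (norm (A $ i) * norm x) ^ 2)"
    by (intro sum_mono) (metis Cauchy_Schwarz_ineq2 abs_ge_zero power2_abs power_mono)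
  also have "\<dots> = (norm A * norm x) ^ 2"
    by (simp add: norm_vec_def[of A] L2_set_def power_mult_distrib sum_nonneg sum_distrib_right)
  finally show "norm (A *v x) \<le> norm A * norm x"
    by (rule power2_le_imp_le) simp
qed

text \<open>Equality case of Cauchy-Schwarz: with w = A^T A v and s the spectral norm, |w| \<le> s^2
  |v| and v . w = s^2 |v|^2, so expanding |w - s^2 v|^2 leaves at most 0.\<close>

lemma top_singular_vector:
  fixes A :: "real^'n^'m"
  assumes "norm (A *v v) = spectral_norm A * norm v"
  shows "transpose A *v (A *v v) = (spectral_norm A)\<^sup>2 *\<^sub>R v"
proof -
  let ?s = "spectral_norm A"
  let ?w = "transpose A *v (A *v v)"
  have "norm ?w \<le> ?s * (?s * norm v)"
    using norm_mult_vector_le[of "transpose A" "A *v v"] assms by (simp add: spectral_norm_transpose)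
  then have "norm ?w ^ 2 \<le> (?s * (?s * norm v)) ^ 2"
    by (intro power_mono) auto
  moreover have "v \<bullet> ?w = (?s * norm v) ^ 2"
    by (simp only: assms[symmetric] power2_norm_eq_inner inner_transpose_mult_vector)
  moreover have "norm (?w - ?s\<^sup>2 *\<^sub>R v) ^ 2 = norm ?w ^ 2 - 2 * ?s\<^sup>2 * (v \<bullet> ?w) + ?s ^ 4 * norm v ^ 2"
    unfolding power2_norm_eq_inner
    by (simp add: inner_diff inner_commute power2_eq_square power4_eq_xxxx del: transpose_matrix_vector)
  ultimately have "norm (?w - ?s\<^sup>2 *\<^sub>R v) ^ 2 \<le> 0"
    by (simp add: power_mult_distrib algebra_simps power2_eq_square power4_eq_xxxx)
  then show ?thesis by simp
qed

text \<open>The rank-one matrix u v^T. Extremal matrices are built from singular vectors in this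
  form, since left multiplication acts only on u and right multiplication only on v.\<close>

definition outer_product :: "real^'m \<Rightarrow> real^'n \<Rightarrow> real^'n^'m"
  where "outer_product u v = (\<chi> i j. u $ i * v $ j)"

lemma matrix_mult_outer_product: "A ** outer_product u v = outer_product (A *v u) v"
  by (simp add: outer_product_def vec_eq_iff matrix_matrix_mult_def matrix_vector_mult_def
      sum_distrib_right mult.assoc)

lemma outer_product_matrix_mult: "outer_product u v ** A = outer_product u (transpose A *v v)"
  by (simp add: outer_product_def vec_eq_iff matrix_matrix_mult_def vector_matrix_mult_def
      sum_distrib_left mult_ac)

lemma outer_product_mult_vector: "outer_product u v *v x = (v \<bullet> x) *\<^sub>R u"
  by (simp add: outer_product_def vec_eq_iff matrix_vector_mult_def inner_vec_def
      sum_distrib_left mult_ac)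

lemma transpose_outer_product: "transpose (outer_product u v) = outer_product v u"
  by (simp add: outer_product_def vec_eq_iff transpose_def mult_ac)

lemma outer_product_scaleR_left: "outer_product (c *\<^sub>R u) v = c *\<^sub>R outer_product u v"
  by (simp add: outer_product_def vec_eq_iff)

lemma outer_product_scaleR_right: "outer_product u (c *\<^sub>R v) = c *\<^sub>R outer_product u v"
  by (simp add: outer_product_def vec_eq_iff)

lemma norm_outer_product: "norm (outer_product u v) = norm u * norm v"
proof -
  have "norm (outer_product u v) ^ 2 = (norm u * norm v) ^ 2"
    unfolding power_mult_distrib power2_norm_eq_inner
    by (simp add: outer_product_def inner_vec_def sum_product) (simp add: mult_ac)
  then show ?thesis by (simp add: power2_eq_iff_nonneg)
qed

subsection \<open>Hessian of the loss\<close>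

lemma bounded_linear_transpose: "bounded_linear (transpose :: real^'n^'m \<Rightarrow> real^'m^'n)"
  unfolding linear_conv_bounded_linear[symmetric]
  by (rule linearI) (simp_all add: transpose_add transpose_scalar)

lemmas has_derivative_transpose = bounded_linear.has_derivative[OF bounded_linear_transpose]

lemma GDERIV_unique:
  assumes "GDERIV f x :> D" "GDERIV f x :> E"
  shows "D = E"
proof -
  have "(\<lambda>h. h \<bullet> D) = (\<lambda>h. h \<bullet> E)"
    using assms unfolding gderiv_def by (rule has_derivative_unique)
  then have "(D - E) \<bullet> D = (D - E) \<bullet> E"
    by metis
  then have "(D - E) \<bullet> (D - E) = 0"
    by (simp add: inner_diff_right)
  then show ?thesis by simp
qed

text \<open>With residual R the derivative is (H, K) |-> R . (X K + H Y); moving X and Y across the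
  inner product reads off the representing pair.\<close>

lemma gradient_factorization_loss:
  fixes M :: "real^'n^'m"
  shows "(gradient (factorization_loss M) :: (real^'r^'m) \<times> (real^'n^'r) \<Rightarrow> _) =
    (\<lambda>p. ((fst p ** snd p - M) ** transpose (snd p), transpose (fst p) ** (fst p ** snd p - M)))"
proof
  fix p :: "(real^'r^'m) \<times> (real^'n^'r)"
  let ?R = "fst p ** snd p - M"
  have "factorization_loss M = (\<lambda>p :: (real^'r^'m) \<times> (real^'n^'r). (fst p ** snd p - M) \<bullet> (fst p ** snd p - M) / 2)"
    by (auto simp: factorization_loss_def power2_norm_eq_inner)
  moreover have "((\<lambda>p :: (real^'r^'m) \<times> (real^'n^'r). (fst p ** snd p - M) \<bullet> (fst p ** snd p - M) / 2) has_derivative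
      (\<lambda>h. ?R \<bullet> (fst p ** snd h + fst h ** snd p))) (at p)"
    by (auto intro!: derivative_eq_intros matrix_mult.FDERIV simp: inner_commute)
  moreover have "?R \<bullet> (fst p ** snd h + fst h ** snd p) =
      h \<bullet> (?R ** transpose (snd p), transpose (fst p) ** ?R)" for h
    using inner_matrix_mult_right[of "fst h" "snd p" ?R] inner_matrix_mult_left[of "fst p" "snd h" ?R]
    by (simp add: inner_prod_def inner_add_right inner_commute[of ?R])
  ultimately have "GDERIV (factorization_loss M) p :> (?R ** transpose (snd p), transpose (fst p) ** ?R)"
    by (simp add: gderiv_def)
  then show "gradient (factorization_loss M) p = (?R ** transpose (snd p), transpose (fst p) ** ?R)"
    unfolding gradient_def by (blast intro: GDERIV_unique)
qed

text \<open>The product rule also differentiates the transposed factors, but those terms contain the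
  residual X Y - M, which is zero here. What remains is L^* L.\<close>

lemma hessian_factorization_loss:
  fixes X :: "real^'r^'m" and Y :: "real^'n^'r"
  assumes "X ** Y = M"
  shows "hessian (factorization_loss M) (X, Y) =
    (\<lambda>(H, K). ((X ** K + H ** Y) ** transpose Y, transpose X ** (X ** K + H ** Y)))"
proof -
  have "(gradient (factorization_loss M) has_derivative
      (\<lambda>(H, K). ((X ** K + H ** Y) ** transpose Y, transpose X ** (X ** K + H ** Y)))) (at (X, Y))"
    unfolding gradient_factorization_loss
    by (rule derivative_eq_intros matrix_mult.FDERIV has_derivative_transpose refl)+
      (simp add: assms split_beta fun_eq_iff)
  then show ?thesis
    unfolding hessian_def by (rule frechet_derivative_at[symmetric])
qed

text \<open>The mixed Frobenius-spectral bounds, followed by Cauchy-Schwarz in the plane for the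
  pair of spectral norms and the pair (|K|, |H|).\<close>

lemma norm_linearization_le:
  "norm (X ** K + H ** Y) \<le> sqrt ((spectral_norm X)\<^sup>2 + (spectral_norm Y)\<^sup>2) * norm (H, K)"
proof -
  let ?a = "spectral_norm X" and ?b = "spectral_norm Y"
  have "norm (X ** K + H ** Y) \<le> ?a * norm K + norm H * ?b"
    by (intro norm_triangle_le add_mono norm_matrix_mult_le_spectral_norm_left
        norm_matrix_mult_le_spectral_norm_right)
  also have "\<dots> = (?a, ?b) \<bullet> (norm K, norm H)"
    by simp
  also have "\<dots> \<le> norm (?a, ?b) * norm (norm K, norm H)"
    by (rule norm_cauchy_schwarz)
  finally show ?thesis
    by (simp add: norm_Pair add.commute)
qed

text \<open>Take Z = u v^T with u a top left singular vector of X and v a top right singular vector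
  of Y. This Z is an eigenvector of both summands of L L^* at once.\<close>

lemma joint_top_singular_matrix:
  fixes X :: "real^'r^'m" and Y :: "real^'n^'r"
  obtains Z where "norm Z = 1"
    "X ** (transpose X ** Z) = (spectral_norm X)\<^sup>2 *\<^sub>R Z"
    "(Z ** transpose Y) ** Y = (spectral_norm Y)\<^sup>2 *\<^sub>R Z"
proof -
  obtain u where u: "norm u = 1" "norm (transpose X *v u) = spectral_norm X"
    using spectral_norm_attained[of "transpose X"] by (metis spectral_norm_transpose)
  obtain v where v: "norm v = 1" "norm (Y *v v) = spectral_norm Y"
    using spectral_norm_attained by blast
  have "X *v (transpose X *v u) = (spectral_norm X)\<^sup>2 *\<^sub>R u"
    using top_singular_vector[of "transpose X" u] u
    by (simp add: spectral_norm_transpose del: transpose_matrix_vector)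
  moreover have "transpose Y *v (Y *v v) = (spectral_norm Y)\<^sup>2 *\<^sub>R v"
    using top_singular_vector[of Y v] v by simp
  ultimately show ?thesis
    using that[of "outer_product u v"] u v
    by (simp add: norm_outer_product matrix_mult_outer_product outer_product_matrix_mult
        outer_product_scaleR_left outer_product_scaleR_right del: transpose_matrix_vector)
qed

lemma largest_eigenvalue_hessian:
  fixes X :: "real^'r^'m" and Y :: "real^'n^'r"
  assumes "X ** Y = M"
  shows "largest_eigenvalue (hessian (factorization_loss M) (X, Y)) =
    (spectral_norm X)\<^sup>2 + (spectral_norm Y)\<^sup>2"
  unfolding largest_eigenvalue_def
proof (rule Greatest_equality)
  let ?A = "hessian (factorization_loss M) (X, Y)"
  let ?l = "(spectral_norm X)\<^sup>2 + (spectral_norm Y)\<^sup>2"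
  obtain Z where Z: "norm Z = 1" "X ** (transpose X ** Z) = (spectral_norm X)\<^sup>2 *\<^sub>R Z"
      "(Z ** transpose Y) ** Y = (spectral_norm Y)\<^sup>2 *\<^sub>R Z"
    by (rule joint_top_singular_matrix)
  show "is_eigenvalue ?A ?l"
  \<comment> \<open>For \<open>?l = 0\<close> both factors vanish, and L^* Z with them; the Hessian
    is then 0 and any nonzero vector serves.\<close>
  proof (cases "?l = 0")
    case True
    then have "X = 0" "Y = 0"
      by (simp_all add: sum_power2_eq_zero_iff spectral_norm_eq_0)
    moreover obtain v :: "(real^'r^'m) \<times> (real^'n^'r)" where "v \<noteq> 0"
      using nonempty_Basis nonzero_Basis by blast
    ultimately show ?thesis
      using True unfolding is_eigenvalue_def hessian_factorization_loss[OF assms]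
      by (intro exI[of _ v]) (simp add: split_beta zero_prod_def)
  next
    case False
    \<comment> \<open>The pair is L^* Z. Since L maps it to \<open>?l\<close> Z, it is nonzero, and
      L^* L multiplies it by \<open>?l\<close>.\<close>
    let ?H = "Z ** transpose Y" and ?K = "transpose X ** Z"
    have L: "X ** ?K + ?H ** Y = ?l *\<^sub>R Z"
      by (simp add: Z scaleR_left_distrib)
    have "(?H, ?K) \<noteq> 0"
    proof
      assume "(?H, ?K) = 0"
      then have "?l *\<^sub>R Z = 0"
        using L by (simp add: zero_prod_def)
      with False Z(1) show False by auto
    qed
    moreover have "?A (?H, ?K) = ?l *\<^sub>R (?H, ?K)"
      by (simp add: hessian_factorization_loss[OF assms] L matrix_mult.scaleR_left matrix_mult.scaleR_right)
    ultimately show ?thesis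
      unfolding is_eigenvalue_def by blast
  qed
  fix c assume "is_eigenvalue ?A c"
  then obtain H K where HK: "(H, K) \<noteq> 0" "?A (H, K) = c *\<^sub>R (H, K)"
    unfolding is_eigenvalue_def by auto
  let ?L = "X ** K + H ** Y"
  \<comment> \<open>Rayleigh quotient: c |(H, K)|^2 = |L (H, K)|^2.\<close>
  have "c * norm (H, K) ^ 2 = ?A (H, K) \<bullet> (H, K)"
    by (simp only: HK(2) power2_norm_eq_inner inner_scaleR_left)
  also have "\<dots> = ?L \<bullet> ?L"
    using inner_matrix_mult_right[of ?L "transpose Y" H] inner_matrix_mult_left[of "transpose X" ?L K]
    by (simp add: hessian_factorization_loss[OF assms] inner_add_right)
  also have "\<dots> \<le> (sqrt ?l * norm (H, K)) ^ 2"
    unfolding power2_norm_eq_inner[symmetric]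
    by (intro power_mono norm_linearization_le) simp
  finally have "c * norm (H, K) ^ 2 \<le> ?l * norm (H, K) ^ 2"
    by (simp add: power_mult_distrib)
  with HK(1) show "c \<le> ?l" by simp
qed

subsection \<open>Variation of the loss on small balls\<close>

lemma loss_variation:
  assumes "X ** Y = M"
  shows "\<bar>factorization_loss M ((X, Y) + (H, K)) - factorization_loss M (X, Y)\<bar> =
    (norm (X ** K + H ** Y + H ** K))\<^sup>2 / 2"
proof -
  have "(X + H) ** (Y + K) - M = X ** K + H ** Y + H ** K"
    using assms by (simp add: matrix_mult.add_left matrix_mult.add_right)
  with assms show ?thesis by (simp add: factorization_loss_def)
qed

text \<open>Submultiplicativity and the arithmetic-geometric mean inequality. This controls the
  second-order part of the residual.\<close>

lemma norm_matrix_mult_le_half: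
  fixes H :: "real^'r^'m" and K :: "real^'n^'r"
  shows "norm (H ** K) \<le> (norm (H, K))\<^sup>2 / 2"
proof -
  have "norm (H ** K) \<le> norm H * norm K"
    by (rule order_trans[OF norm_matrix_mult_le_spectral_norm_right])
      (simp add: mult_left_mono spectral_norm_le_norm)
  also have "\<dots> \<le> ((norm H)\<^sup>2 + (norm K)\<^sup>2) / 2"
    using sum_squares_bound[of "norm H" "norm K"] by simp
  finally show ?thesis by (simp add: norm_Pair)
qed

lemma max_variation_loss_upper:
  fixes X :: "real^'r^'m" and Y :: "real^'n^'r"
  assumes "X ** Y = M"
  defines "l \<equiv> sqrt ((spectral_norm X)\<^sup>2 + (spectral_norm Y)\<^sup>2)"
  shows "max_variation (factorization_loss M) (X, Y) \<rho> \<le> ereal ((l * \<rho> + \<rho>\<^sup>2 / 2)\<^sup>2 / 2)"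
  unfolding max_variation_def
proof (rule SUP_least)
  fix y assume "y \<in> cball (X, Y) \<rho>"
  then obtain H K where y: "y = (X, Y) + (H, K)" and HK: "norm (H, K) \<le> \<rho>"
    by (metis add.commute diff_add_cancel dist_commute dist_norm mem_cball surj_pair)
  have "norm (X ** K + H ** Y + H ** K) \<le> l * norm (H, K) + (norm (H, K))\<^sup>2 / 2"
    unfolding l_def by (intro norm_triangle_le add_mono norm_linearization_le norm_matrix_mult_le_half)
  also have "\<dots> \<le> l * \<rho> + \<rho>\<^sup>2 / 2"
    using HK by (intro add_mono mult_left_mono divide_right_mono power_mono) (auto simp: l_def)
  finally show "ereal \<bar>factorization_loss M y - factorization_loss M (X, Y)\<bar>
      \<le> ereal ((l * \<rho> + \<rho>\<^sup>2 / 2)\<^sup>2 / 2)"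
    unfolding y loss_variation[OF assms(1)] by (simp add: power_mono)
qed

lemma max_variation_loss_ge:
  assumes "X ** Y = M" "norm (H, K) \<le> \<rho>" "0 \<le> c" "c \<le> norm (X ** K + H ** Y + H ** K)"
  shows "ereal (c\<^sup>2 / 2) \<le> max_variation (factorization_loss M) (X, Y) \<rho>"
  unfolding max_variation_def
proof (rule SUP_upper2)
  show "(X, Y) + (H, K) \<in> cball (X, Y) \<rho>"
    using assms(2) by (simp add: dist_norm norm_Pair)
  show "ereal (c\<^sup>2 / 2) \<le>
      ereal \<bar>factorization_loss M ((X, Y) + (H, K)) - factorization_loss M (X, Y)\<bar>"
    using assms(3,4) unfolding loss_variation[OF assms(1)] by (simp add: power_mono)
qed

text \<open>The displacement along L^* Z of length \<rho> has linear part l \<rho> Z, and the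
  quadratic part cancels at most \<rho>^2 / 2 of it. The condition \<rho> \<le> 2 l keeps the
  difference nonnegative, so that squaring is monotone.\<close>

lemma max_variation_loss_lower:
  fixes X :: "real^'r^'m" and Y :: "real^'n^'r"
  assumes "X ** Y = M" "0 \<le> \<rho>"
  defines "l \<equiv> sqrt ((spectral_norm X)\<^sup>2 + (spectral_norm Y)\<^sup>2)"
  assumes "\<rho> \<le> 2 * l" "0 < l"
  shows "ereal ((l * \<rho> - \<rho>\<^sup>2 / 2)\<^sup>2 / 2) \<le> max_variation (factorization_loss M) (X, Y) \<rho>"
proof -
  obtain Z where Z: "norm Z = 1" "X ** (transpose X ** Z) = (spectral_norm X)\<^sup>2 *\<^sub>R Z"
      "(Z ** transpose Y) ** Y = (spectral_norm Y)\<^sup>2 *\<^sub>R Z"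
    by (rule joint_top_singular_matrix)
  let ?H = "(\<rho> / l) *\<^sub>R (Z ** transpose Y)" and ?K = "(\<rho> / l) *\<^sub>R (transpose X ** Z)"
  have l2: "l\<^sup>2 = (spectral_norm X)\<^sup>2 + (spectral_norm Y)\<^sup>2"
    by (simp add: l_def)
  have "X ** ?K + ?H ** Y = (\<rho> / l) *\<^sub>R (l\<^sup>2 *\<^sub>R Z)"
    by (simp only: l2 Z matrix_mult.scaleR_left matrix_mult.scaleR_right scaleR_add_right scaleR_left_distrib)
  also have "\<dots> = (l * \<rho>) *\<^sub>R Z"
    using \<open>0 < l\<close> by (simp add: power2_eq_square)
  finally have L: "norm (X ** ?K + ?H ** Y) = l * \<rho>"
    using \<open>0 \<le> \<rho>\<close> \<open>0 < l\<close> Z(1) by simp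
  have "(norm (Z ** transpose Y))\<^sup>2 = (spectral_norm Y)\<^sup>2"
    using inner_matrix_mult_right[of Z "transpose Y" "Z ** transpose Y"] Z(1,3)
    by (simp add: power2_norm_eq_inner norm_eq_1)
  moreover have "(norm (transpose X ** Z))\<^sup>2 = (spectral_norm X)\<^sup>2"
    using inner_matrix_mult_left[of "transpose X" Z "transpose X ** Z"] Z(1,2)
    by (simp add: power2_norm_eq_inner norm_eq_1)
  ultimately have "(norm (?H, ?K))\<^sup>2 = (\<rho> / l)\<^sup>2 * l\<^sup>2"
    by (simp add: norm_Pair l2 power_mult_distrib power_divide distrib_left)
  then have "(norm (?H, ?K))\<^sup>2 = \<rho>\<^sup>2"
    using \<open>0 < l\<close> by (simp add: power_divide)
  then have N: "norm (?H, ?K) = \<rho>"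
    using \<open>0 \<le> \<rho>\<close> by (simp add: power2_eq_iff_nonneg)
  show ?thesis
  proof (rule max_variation_loss_ge[OF assms(1)])
    show "norm (?H, ?K) \<le> \<rho>" using N by simp
    show "0 \<le> l * \<rho> - \<rho>\<^sup>2 / 2"
      using mult_right_mono[OF \<open>\<rho> \<le> 2 * l\<close> \<open>0 \<le> \<rho>\<close>] by (simp add: power2_eq_square)
    show "l * \<rho> - \<rho>\<^sup>2 / 2 \<le> norm (X ** ?K + ?H ** Y + ?H ** ?K)"
      using norm_matrix_mult_le_half[of ?H ?K] norm_diff_ineq[of "X ** ?K + ?H ** Y" "?H ** ?K"]
      unfolding L N by simp
  qed
qed

text \<open>If l > l', the lower bound for l and the upper bound for l' give (l - l') \<rho> \<le>
  \<rho>^2, which fails for small \<rho>.\<close>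

lemma flatter_eq_imp_le:
  fixes X X' :: "real^'r^'m" and Y Y' :: "real^'n^'r"
  assumes "X ** Y = M" "X' ** Y' = M" "flatter_eq (factorization_loss M) (X, Y) (X', Y')"
  shows "(spectral_norm X)\<^sup>2 + (spectral_norm Y)\<^sup>2 \<le> (spectral_norm X')\<^sup>2 + (spectral_norm Y')\<^sup>2"
proof -
  define l where "l = sqrt ((spectral_norm X)\<^sup>2 + (spectral_norm Y)\<^sup>2)"
  define l' where "l' = sqrt ((spectral_norm X')\<^sup>2 + (spectral_norm Y')\<^sup>2)"
  have "l \<le> l'"
  proof (rule ccontr)
    assume "\<not> l \<le> l'"
    moreover have "0 \<le> l'" by (simp add: l'_def)
    ultimately have l: "0 < l" "0 \<le> l'" "l' < l" by auto
    obtain \<rho>0 where "0 < \<rho>0" and \<rho>0: "\<And>\<rho>. 0 < \<rho> \<Longrightarrow> \<rho> \<le> \<rho>0 \<Longrightarrow>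
        max_variation (factorization_loss M) (X, Y) \<rho> \<le> max_variation (factorization_loss M) (X', Y') \<rho>"
      using assms(3) unfolding flatter_eq_def by auto
    \<comment> \<open>Half the gap lies strictly below l - l', and also below 2 l as the lower bound
      requires.\<close>
    define \<rho> where "\<rho> = min \<rho>0 ((l - l') / 2)"
    have \<rho>: "0 < \<rho>" "\<rho> \<le> \<rho>0" "\<rho> < l - l'" "\<rho> \<le> 2 * l"
      using l \<open>0 < \<rho>0\<close> by (auto simp: \<rho>_def min_def)
    have "ereal ((l * \<rho> - \<rho>\<^sup>2 / 2)\<^sup>2 / 2) \<le> ereal ((l' * \<rho> + \<rho>\<^sup>2 / 2)\<^sup>2 / 2)"
      using max_variation_loss_lower[OF assms(1), of \<rho>] max_variation_loss_upper[OF assms(2), of \<rho>]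
        \<rho>0[of \<rho>] \<rho> l unfolding l_def[symmetric] l'_def[symmetric] by (meson less_imp_le order_trans)
    then have "(l * \<rho> - \<rho>\<^sup>2 / 2)\<^sup>2 \<le> (l' * \<rho> + \<rho>\<^sup>2 / 2)\<^sup>2"
      by simp
    then have "l * \<rho> - \<rho>\<^sup>2 / 2 \<le> l' * \<rho> + \<rho>\<^sup>2 / 2"
      using \<rho> l by (intro power2_le_imp_le[of "l * \<rho> - \<rho>\<^sup>2 / 2"]) auto
    then have "(l - l') * \<rho> \<le> \<rho> * \<rho>"
      by (simp add: algebra_simps power2_eq_square)
    with \<rho> show False by simp
  qed
  then show ?thesis by (simp add: l_def l'_def)
qed

text \<open>Since |M| = |X| |Y|, a top right singular vector v of M loses nothing on its way through
  Y and X: for s > 0, Y v = s w and X w = s u with unit w and u. Then Z = u v^T, H = u w^T and K = w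
  v^T, and H^T H and K K^T both equal w w^T.\<close>

lemma balanced_top_singular_matrices:
  fixes X :: "real^'r^'m" and Y :: "real^'n^'r"
  assumes M: "X ** Y = M"
    and bal: "spectral_norm X = s" "spectral_norm Y = s" "spectral_norm M = s\<^sup>2"
  obtains Z H K where "norm Z = 1" "norm H = 1" "norm K = 1" "H ** K = Z"
    "X ** K = s *\<^sub>R Z" "H ** Y = s *\<^sub>R Z"
    "Z ** transpose Y = s *\<^sub>R H" "transpose X ** Z = s *\<^sub>R K"
    "transpose H ** H = K ** transpose K"
proof -
  have "\<exists>u w v. norm u = 1 \<and> norm w = 1 \<and> norm v = 1 \<and> X *v w = s *\<^sub>R u \<and> Y *v v = s *\<^sub>R w \<and>
      transpose X *v u = s *\<^sub>R w \<and> transpose Y *v w = s *\<^sub>R v"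
  \<comment> \<open>For s = 0 both factors vanish and arbitrary unit vectors satisfy the
    equations.\<close>
  proof (cases "s = 0")
    case True
    then have "X = 0" "Y = 0"
      using bal by (simp_all add: spectral_norm_eq_0)
    moreover obtain u :: "real^'m" where "norm u = 1"
      using vector_choose_size[of 1] by auto
    moreover obtain w :: "real^'r" where "norm w = 1"
      using vector_choose_size[of 1] by auto
    moreover obtain v :: "real^'n" where "norm v = 1"
      using vector_choose_size[of 1] by auto
    ultimately show ?thesis
      using True by (metis matrix_vector_mult_0 scaleR_zero_left transpose_matrix_vector
          vector_matrix_mult_0_right)
  next
    case False
    then have "0 < s"
      using spectral_norm_nonneg[of X] bal by simp
    obtain v where v: "norm v = 1" "norm (M *v v) = s\<^sup>2"
      using spectral_norm_attained[of M] bal by auto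
    define w where "w = (1 / s) *\<^sub>R (Y *v v)"
    define u where "u = (1 / s) *\<^sub>R (X *v w)"
    have Yv: "Y *v v = s *\<^sub>R w" and Xw: "X *v w = s *\<^sub>R u"
      using \<open>0 < s\<close> by (simp_all add: w_def u_def)
    have "M *v v = s\<^sup>2 *\<^sub>R u"
      by (simp add: M[symmetric] Yv Xw matrix_vector_mult_scaleR power2_eq_square
          flip: matrix_vector_mul_assoc)
    then have u: "norm u = 1"
      using v \<open>0 < s\<close> by simp
    \<comment> \<open>The norm of Y gives |w| \<le> 1, and X w = s u with |u| = 1 gives |w| \<ge>
      1.\<close>
    have "norm w \<le> 1"
      using norm_mult_vector_le[of Y v] v \<open>0 < s\<close> by (simp add: Yv bal)
    moreover have "1 \<le> norm w"
      using norm_mult_vector_le[of X w] u \<open>0 < s\<close> by (simp add: Xw bal)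
    ultimately have w: "norm w = 1" by simp
    have "transpose X *v (X *v w) = s\<^sup>2 *\<^sub>R w"
      using top_singular_vector[of X w] u w \<open>0 < s\<close> by (simp add: Xw bal)
    then have Xu: "transpose X *v u = s *\<^sub>R w"
      using \<open>0 < s\<close> by (simp add: Xw matrix_vector_mult_scaleR power2_eq_square
          flip: scaleR_scaleR del: transpose_matrix_vector)
    have "transpose Y *v (Y *v v) = s\<^sup>2 *\<^sub>R v"
      using top_singular_vector[of Y v] v w \<open>0 < s\<close> by (simp add: Yv bal)
    then have Yw: "transpose Y *v w = s *\<^sub>R v"
      using \<open>0 < s\<close> by (simp add: Yv matrix_vector_mult_scaleR power2_eq_square
          flip: scaleR_scaleR del: transpose_matrix_vector)
    show ?thesis
      using u w v Xw Yv Xu Yw by blast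
  qed
  then obtain u w v where n: "norm u = 1" "norm w = 1" "norm v = 1"
    and e: "X *v w = s *\<^sub>R u" "Y *v v = s *\<^sub>R w" "transpose X *v u = s *\<^sub>R w" "transpose Y *v w = s *\<^sub>R v"
    by blast
  have ip: "u \<bullet> u = 1" "w \<bullet> w = 1" "v \<bullet> v = 1"
    using n by (simp_all add: norm_eq_1)
  show ?thesis
    by (rule that[of "outer_product u v" "outer_product u w" "outer_product w v"])
      (use n ip in \<open>simp_all add: e norm_outer_product matrix_mult_outer_product outer_product_matrix_mult
        outer_product_mult_vector transpose_outer_product
        outer_product_scaleR_left outer_product_scaleR_right del: transpose_matrix_vector\<close>)
qed

text \<open>Along H and K from the common singular vectors, the linear and the quadratic part are
  nonnegative multiples of the same Z, and |H| = |K| makes the mean inequality an equality. So the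
  general upper bound is attained.\<close>

lemma max_variation_loss_balanced:
  fixes X :: "real^'r^'m" and Y :: "real^'n^'r"
  assumes M: "X ** Y = M"
    and bal: "spectral_norm X = s" "spectral_norm Y = s" "spectral_norm M = s\<^sup>2"
    and "0 \<le> \<rho>"
  shows "ereal ((sqrt (s\<^sup>2 + s\<^sup>2) * \<rho> + \<rho>\<^sup>2 / 2)\<^sup>2 / 2) \<le> max_variation (factorization_loss M) (X, Y) \<rho>"
proof -
  obtain Z H K where Z: "norm Z = 1" "norm H = 1" "norm K = 1" "H ** K = Z"
    "X ** K = s *\<^sub>R Z" "H ** Y = s *\<^sub>R Z"
    by (rule balanced_top_singular_matrices[OF M bal])
  define h where "h = \<rho> / sqrt 2"
  have h: "0 \<le> h" "h\<^sup>2 = \<rho>\<^sup>2 / 2" "\<rho> = sqrt 2 * h"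
    using \<open>0 \<le> \<rho>\<close> by (simp_all add: h_def power_divide)
  have "0 \<le> s"
    using bal spectral_norm_nonneg by metis
  have "sqrt (s\<^sup>2 + s\<^sup>2) = sqrt 2 * s"
    using \<open>0 \<le> s\<close> by (simp add: real_sqrt_mult flip: mult_2)
  then have "sqrt (s\<^sup>2 + s\<^sup>2) * \<rho> = (sqrt 2 * sqrt 2) * h * s"
    by (simp only: h(3) mult_ac)
  then have c: "sqrt (s\<^sup>2 + s\<^sup>2) * \<rho> + \<rho>\<^sup>2 / 2 = 2 * h * s + h\<^sup>2"
    using h(2) by simp
  have "X ** (h *\<^sub>R K) + (h *\<^sub>R H) ** Y + (h *\<^sub>R H) ** (h *\<^sub>R K) = (2 * h * s + h\<^sup>2) *\<^sub>R Z"
    by (simp add: Z matrix_mult.scaleR_left matrix_mult.scaleR_right algebra_simps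
        power2_eq_square flip: scaleR_2)
  moreover have "norm (h *\<^sub>R H, h *\<^sub>R K) = \<rho>"
    using h Z by (simp add: norm_Pair real_sqrt_mult flip: mult_2)
  ultimately show ?thesis
    unfolding c using h \<open>0 \<le> s\<close> Z(1)
    by (intro max_variation_loss_ge[OF M, of "h *\<^sub>R H" "h *\<^sub>R K"]) auto
qed

subsection \<open>Local minima of the largest eigenvalue\<close>

text \<open>For a unit maximizer u of |A u| and v = A u, the first-order change of |A u|^2 is 2 t (S
  v . v) < 0; compactness makes the decrease uniform. The implicit form C = A + t S C stands for (I
  - t S)^(-1) A, so that no inverse has to be expanded.\<close>

lemma spectral_norm_decrease:
  fixes A :: "real^'n^'r" and S :: "real^'r^'r"
  assumes "A \<noteq> 0"
    and neg: "\<And>v. v \<noteq> 0 \<Longrightarrow> A *v (transpose A *v v) = (spectral_norm A)\<^sup>2 *\<^sub>R v \<Longrightarrow> (S *v v) \<bullet> v < 0"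
  shows "\<exists>\<delta>>0. \<forall>t C. 0 < t \<and> t < \<delta> \<and> (C = A + t *\<^sub>R (S ** A) \<or> C = A + t *\<^sub>R (S ** C)) \<longrightarrow>
    spectral_norm C < spectral_norm A"
proof (rule ccontr)
  assume contra: "\<not> ?thesis"
  let ?s = "spectral_norm A" and ?\<sigma> = "spectral_norm S"
  \<comment> \<open>This forces \<open>t n * ?\<sigma>\<close> \<le> 1 / (2 (n + 1)); the + 1 in the
    denominator avoids division by 0.\<close>
  let ?e = "\<lambda>n. inverse (real (Suc n)) / (2 * ?\<sigma> + 1)"
  have pos: "0 < 2 * ?\<sigma> + 1"
    using spectral_norm_nonneg[of S] by simp
  have "0 < ?s"
    using \<open>A \<noteq> 0\<close> spectral_norm_eq_0[of A] spectral_norm_nonneg[of A] by linarith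
  have "\<exists>t C. 0 < t \<and> t < ?e n \<and> (C = A + t *\<^sub>R (S ** A) \<or> C = A + t *\<^sub>R (S ** C)) \<and> ?s \<le> spectral_norm C" for n
  proof -
    have "0 < ?e n" using pos by simp
    with contra show ?thesis by (meson not_le)
  qed
  then obtain t C where t: "\<And>n. 0 < t n" "\<And>n. t n < ?e n"
    and C: "\<And>n. C n = A + t n *\<^sub>R (S ** A) \<or> C n = A + t n *\<^sub>R (S ** C n)"
    and sC: "\<And>n. ?s \<le> spectral_norm (C n)"
    by metis
  have "\<exists>u. norm u = 1 \<and> norm (C n *v u) = spectral_norm (C n)" for n
    using spectral_norm_attained[of "C n"] by blast
  then obtain u where u: "\<And>n. norm (u n) = 1" "\<And>n. norm (C n *v u n) = spectral_norm (C n)"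
    by metis
  define a where "a n = A *v u n" for n
  define c where "c n = C n *v u n" for n
  \<comment> \<open>\<open>d n\<close> is the vector S acts on: \<open>a n\<close> in the explicit
    form, \<open>c n\<close> in the implicit one.\<close>
  have "\<exists>d. c n = a n + t n *\<^sub>R (S *v d) \<and> (d = a n \<or> d = c n)" for n
    using C[of n]
  proof
    assume "C n = A + t n *\<^sub>R (S ** A)"
    then have "c n = a n + t n *\<^sub>R (S *v a n)"
      unfolding c_def a_def
      by (metis matrix_vector_mul_assoc matrix_vector_mult_add_rdistrib scaleR_matrix_vector_assoc)
    then show ?thesis by blast
  next
    assume "C n = A + t n *\<^sub>R (S ** C n)"
    then have "c n = a n + t n *\<^sub>R (S *v c n)"
      unfolding c_def a_def
      by (metis matrix_vector_mul_assoc matrix_vector_mult_add_rdistrib scaleR_matrix_vector_assoc)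
    then show ?thesis by blast
  qed
  then obtain d where d: "\<And>n. c n = a n + t n *\<^sub>R (S *v d n)" "\<And>n. d n = a n \<or> d n = c n"
    by metis
  have a_le: "norm (a n) \<le> ?s" for n
    using norm_mult_vector_le[of A "u n"] by (simp add: a_def u)
  have c_ge: "?s \<le> norm (c n)" for n
    using sC u by (simp add: c_def)
  have ca: "norm (c n - a n) \<le> inverse (real (Suc n)) * ?s" for n
  proof -
    have "t n * (2 * ?\<sigma> + 1) < inverse (real (Suc n))"
      using t(2)[of n] pos by (simp add: pos_less_divide_eq)
    then have t\<sigma>: "t n * ?\<sigma> \<le> inverse (real (Suc n)) / 2"
      using t(1)[of n] by (simp add: algebra_simps)
    have "norm (c n - a n) \<le> t n * (?\<sigma> * norm (d n))"
      using d(1)[of n] t(1)[of n] norm_mult_vector_le[of S "d n"] by simp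
    also have "\<dots> = (t n * ?\<sigma>) * norm (d n)"
      by simp
    also have "\<dots> \<le> inverse (real (Suc n)) / 2 * norm (d n)"
      by (intro mult_right_mono t\<sigma>) simp
    finally have le: "norm (c n - a n) \<le> inverse (real (Suc n)) / 2 * norm (d n)" .
    also have "\<dots> \<le> 1 / 2 * norm (d n)"
      by (intro mult_right_mono) (auto simp: inverse_eq_divide)
    finally have "norm (c n - a n) \<le> norm (d n) / 2" by simp
    \<comment> \<open>If \<open>d n = c n\<close>, then |c - a| \<le> |c| / 2 gives |c| \<le> 2
      |a|.\<close>
    then have "norm (d n) \<le> 2 * ?s"
      using d(2)[of n] a_le[of n] \<open>0 < ?s\<close> norm_triangle_sub[of "c n" "a n"] by auto
    then have "inverse (real (Suc n)) / 2 * norm (d n) \<le> inverse (real (Suc n)) / 2 * (2 * ?s)"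
      by (intro mult_left_mono) auto
    from order_trans[OF le this] show ?thesis by simp
  qed
  \<comment> \<open>Along a convergent subsequence of maximizers, a, c and d share the limit A u0,
    because c - a tends to 0. Its norm is then exactly \<open>?s\<close>.\<close>
  obtain u0 r where u0: "norm u0 = 1" "strict_mono r" "(u \<circ> r) \<longlonglongrightarrow> u0"
    using compact_sphere[of "0 :: real^'n" 1] u(1) unfolding compact_def by fastforce
  define v where "v = A *v u0"
  have "(\<lambda>n. c n - a n) \<longlonglongrightarrow> 0"
  proof (rule Lim_null_comparison)
    show "\<forall>\<^sub>F n in sequentially. norm (c n - a n) \<le> inverse (real (Suc n)) * ?s"
      using ca by simp
    show "(\<lambda>n. inverse (real (Suc n)) * ?s) \<longlonglongrightarrow> 0"
      using tendsto_mult_left_zero[OF LIMSEQ_inverse_real_of_nat] by blast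
  qed
  then have ca0: "(\<lambda>n. c (r n) - a (r n)) \<longlonglongrightarrow> 0"
    using LIMSEQ_subseq_LIMSEQ[OF _ u0(2)] by (fastforce simp: o_def)
  have da0: "(\<lambda>n. d (r n) - a (r n)) \<longlonglongrightarrow> 0"
  proof (rule Lim_null_comparison)
    show "\<forall>\<^sub>F n in sequentially. norm (d (r n) - a (r n)) \<le> norm (c (r n) - a (r n))"
      using d(2) by (intro always_eventually) (metis diff_self norm_ge_zero norm_zero order_refl)
    show "(\<lambda>n. norm (c (r n) - a (r n))) \<longlonglongrightarrow> 0"
      using ca0 by (rule tendsto_norm_zero)
  qed
  have av: "(\<lambda>n. a (r n)) \<longlonglongrightarrow> v"
    using bounded_linear.tendsto[OF matrix_vector_mul_bounded_linear u0(3)]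
    by (simp add: a_def v_def o_def)
  have cv: "(\<lambda>n. c (r n)) \<longlonglongrightarrow> v"
    using tendsto_add[OF ca0 av] by simp
  have dv: "(\<lambda>n. d (r n)) \<longlonglongrightarrow> v"
    using tendsto_add[OF da0 av] by simp
  have "?s \<le> norm v"
    using c_ge by (intro LIMSEQ_le_const[OF tendsto_norm[OF cv]]) auto
  moreover have "norm v \<le> ?s"
    using norm_mult_vector_le[of A u0] by (simp add: v_def u0)
  ultimately have nv: "norm v = ?s" by simp
  have "transpose A *v v = ?s\<^sup>2 *\<^sub>R u0"
    using top_singular_vector[of A u0] nv by (simp add: v_def u0)
  then have "A *v (transpose A *v v) = ?s\<^sup>2 *\<^sub>R v"
    by (simp add: v_def matrix_vector_mult_scaleR del: transpose_matrix_vector)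
  moreover have "v \<noteq> 0"
    using nv \<open>0 < ?s\<close> by auto
  ultimately have "(S *v v) \<bullet> v < 0"
    by (rule neg[rotated])
  \<comment> \<open>As t S d = c - a, the product t (S d . (c + a)) is |c|^2 - |a|^2 \<ge> 0; the
    sign survives division by t and the limit.\<close>
  moreover have "0 \<le> (S *v v) \<bullet> (v + v)"
  proof (rule LIMSEQ_le_const)
    show "(\<lambda>n. (S *v d (r n)) \<bullet> (c (r n) + a (r n))) \<longlonglongrightarrow> (S *v v) \<bullet> (v + v)"
      by (intro tendsto_intros bounded_linear.tendsto[OF matrix_vector_mul_bounded_linear] dv cv av)
    have "0 \<le> (S *v d n) \<bullet> (c n + a n)" for n
    proof -
      have "t n * ((S *v d n) \<bullet> (c n + a n)) = (c n - a n) \<bullet> (c n + a n)"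
        using d(1)[of n] by simp
      also have "\<dots> = (norm (c n))\<^sup>2 - (norm (a n))\<^sup>2"
        by (simp add: power2_norm_eq_inner algebra_simps inner_commute)
      also have "\<dots> \<ge> 0"
        using a_le[of n] c_ge[of n] by (simp add: power_mono)
      finally show ?thesis
        using t(1)[of n] by (simp add: zero_le_mult_iff)
    qed
    then show "\<exists>N. \<forall>n\<ge>N. 0 \<le> (S *v d (r n)) \<bullet> (c (r n) + a (r n))" by blast
  qed
  ultimately show False
    unfolding inner_add_right by linarith
qed

text \<open>A kernel vector satisfies |x| = t |S x| \<le> |x| / 2, so the kernel is trivial; for
  square matrices a left inverse is a right inverse.\<close>

lemma obtain_perturbed_inverse:
  fixes S :: "real^'r^'r"
  assumes "0 < t" "t * spectral_norm S \<le> 1 / 2"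
  obtains B where "(mat 1 + t *\<^sub>R S) ** B = mat 1"
proof -
  have "x = 0" if "(mat 1 + t *\<^sub>R S) *v x = 0" for x
  proof -
    have "x = - (t *\<^sub>R (S *v x))"
      using that by (simp add: matrix_vector_mult_add_rdistrib eq_neg_iff_add_eq_0
          flip: scaleR_matrix_vector_assoc)
    then have "norm x = t * norm (S *v x)"
      using \<open>0 < t\<close> by (metis abs_of_pos norm_minus_cancel norm_scaleR)
    also have "\<dots> \<le> t * (spectral_norm S * norm x)"
      using \<open>0 < t\<close> by (intro mult_left_mono norm_mult_vector_le) simp
    also have "\<dots> = t * spectral_norm S * norm x" by simp
    also have "\<dots> \<le> 1 / 2 * norm x"
      by (intro mult_right_mono assms) simp
    finally show ?thesis by simp
  qed
  then have "\<exists>B. B ** (mat 1 + t *\<^sub>R S) = mat 1"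
    by (simp add: matrix_left_invertible_ker)
  then show ?thesis
    using that matrix_left_right_inverse by blast
qed

lemma balanced_of_local_min:
  fixes X :: "real^'r^'m" and Y :: "real^'n^'r"
  assumes M: "X ** Y = M" and U: "open U" "(X, Y) \<in> U"
    and s: "spectral_norm X = s" "spectral_norm Y = s"
    and min: "\<And>X' Y'. X' ** Y' = M \<Longrightarrow> (X', Y') \<in> U \<Longrightarrow>
      s\<^sup>2 + s\<^sup>2 \<le> (spectral_norm X')\<^sup>2 + (spectral_norm Y')\<^sup>2"
  shows "spectral_norm M = s\<^sup>2"
proof (cases "s = 0")
  case True
  with s have "X = 0" by (simp add: spectral_norm_eq_0)
  with M True show ?thesis by (auto simp: spectral_norm_eq_0)
next
  case False
  then have "0 < s"
    using spectral_norm_nonneg[of X] s by simp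
  have XY0: "transpose X \<noteq> 0" "Y \<noteq> 0"
    using \<open>0 < s\<close> s spectral_norm_eq_0[of "transpose X"] spectral_norm_eq_0[of Y]
    by (auto simp: spectral_norm_transpose)
  have "\<exists>w. w \<noteq> 0 \<and> transpose X *v (X *v w) = s\<^sup>2 *\<^sub>R w \<and> Y *v (transpose Y *v w) = s\<^sup>2 *\<^sub>R w"
  proof (rule ccontr)
    assume no: "\<not> ?thesis"
    \<comment> \<open>The quadratic form of S compares |Y^T v| with |X v|. With no shared
      eigenvector for s^2 it is negative on those of X^T X and positive on those of Y Y^T, so I + t
      S shrinks X and its inverse shrinks Y.\<close>
    define S where "S = Y ** transpose Y - transpose X ** X"
    have tS: "transpose S = S"
      unfolding S_def using transpose_add[of S "transpose X ** X"]
      by (simp add: S_def matrix_transpose_mul eq_diff_eq)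
    have Sv: "(S *v v) \<bullet> v = (norm (transpose Y *v v))\<^sup>2 - (norm (X *v v))\<^sup>2" for v
    proof -
      have "(Y *v (transpose Y *v v)) \<bullet> v = (norm (transpose Y *v v))\<^sup>2"
        by (simp only: inner_transpose_mult_vector power2_norm_eq_inner)
      moreover have "(transpose X *v (X *v v)) \<bullet> v = (norm (X *v v))\<^sup>2"
        by (simp only: inner_transpose_mult_vector power2_norm_eq_inner transpose_transpose)
      ultimately show ?thesis
        by (simp add: S_def matrix_vector_mult_diff_rdistrib inner_diff_left
            del: transpose_matrix_vector flip: matrix_vector_mul_assoc)
    qed
    have top: "A *v (transpose A *v v) = s\<^sup>2 *\<^sub>R v \<Longrightarrow> norm (transpose A *v v) = s * norm v"
      for A :: "real^'k^'r" and v
    proof -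
      assume "A *v (transpose A *v v) = s\<^sup>2 *\<^sub>R v"
      then have "(norm (transpose A *v v))\<^sup>2 = (s\<^sup>2 *\<^sub>R v) \<bullet> v"
        by (metis inner_transpose_mult_vector power2_norm_eq_inner)
      also have "\<dots> = (s * norm v)\<^sup>2"
        by (simp add: power_mult_distrib power2_norm_eq_inner)
      finally show ?thesis
        using \<open>0 < s\<close> by (simp add: power2_eq_iff_nonneg)
    qed
    have strict: "norm (transpose A *v v) < s * norm v"
      if "spectral_norm A = s" "A *v (transpose A *v v) \<noteq> s\<^sup>2 *\<^sub>R v" for A :: "real^'k^'r" and v
      using top_singular_vector[of "transpose A" v] norm_mult_vector_le[of "transpose A" v] that
      by (auto simp: spectral_norm_transpose less_le simp del: transpose_matrix_vector)
    have "(S *v v) \<bullet> v < 0"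
      if "v \<noteq> 0" "transpose X *v (transpose (transpose X) *v v) = (spectral_norm (transpose X))\<^sup>2 *\<^sub>R v" for v
    proof -
      have "transpose X *v (X *v v) = s\<^sup>2 *\<^sub>R v"
        using that(2) by (simp add: spectral_norm_transpose s del: transpose_matrix_vector)
      moreover from this have "Y *v (transpose Y *v v) \<noteq> s\<^sup>2 *\<^sub>R v"
        using no that(1) by blast
      ultimately have "norm (transpose Y *v v) < norm (X *v v)"
        using top[of "transpose X" v] strict[of Y v] s by (simp del: transpose_matrix_vector)
      then show ?thesis
        unfolding Sv by (simp add: power_strict_mono del: transpose_matrix_vector)
    qed
    \<comment> \<open>Explicit form for X^T: as S is symmetric, X (I + t S) has transpose (I + t S)
      X^T.\<close>
    from spectral_norm_decrease[OF XY0(1) this]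
    obtain \<delta>1 where "0 < \<delta>1" and \<delta>1: "\<And>t C. 0 < t \<Longrightarrow> t < \<delta>1 \<Longrightarrow>
        C = transpose X + t *\<^sub>R (S ** transpose X) \<Longrightarrow> spectral_norm C < s"
      by (auto simp: spectral_norm_transpose s)
    have "((- S) *v v) \<bullet> v < 0"
      if "v \<noteq> 0" "Y *v (transpose Y *v v) = (spectral_norm Y)\<^sup>2 *\<^sub>R v" for v
    proof -
      have Yv: "Y *v (transpose Y *v v) = s\<^sup>2 *\<^sub>R v"
        using that(2) by (simp add: s)
      then have "transpose X *v (transpose (transpose X) *v v) \<noteq> s\<^sup>2 *\<^sub>R v"
        using no that(1) by (simp del: transpose_matrix_vector) blast
      then have "norm (X *v v) < norm (transpose Y *v v)"
        using top[OF Yv] strict[of "transpose X" v] s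
        by (simp add: spectral_norm_transpose del: transpose_matrix_vector)
      then have "0 < (S *v v) \<bullet> v"
        unfolding Sv by (simp add: power_strict_mono del: transpose_matrix_vector)
      moreover have "(- S) *v v = - (S *v v)"
        using matrix_vector_mult_diff_rdistrib[of 0 S v] by simp
      ultimately show ?thesis by simp
    qed
    \<comment> \<open>Implicit form with -S: Y' = (I + t S)^(-1) Y satisfies Y' = Y - t S
      Y'.\<close>
    from spectral_norm_decrease[OF XY0(2) this]
    obtain \<delta>2 where "0 < \<delta>2" and \<delta>2: "\<And>t C. 0 < t \<Longrightarrow> t < \<delta>2 \<Longrightarrow>
        C = Y + t *\<^sub>R ((- S) ** C) \<Longrightarrow> spectral_norm C < s"
      by (auto simp: s)
    obtain \<epsilon> where "0 < \<epsilon>" and \<epsilon>: "ball (X, Y) \<epsilon> \<subseteq> U"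
      using U open_contains_ball by blast
    let ?\<sigma> = "spectral_norm S"
    \<comment> \<open>Bounds the displacement per unit of t. The 2 comes from |Y'| \<le> 2 |Y|; the
      + 1 makes the constant positive and the estimate strict.\<close>
    let ?c = "norm (X ** S) + ?\<sigma> * (2 * norm Y) + 1"
    have "0 < ?c"
      by (intro add_nonneg_pos add_nonneg_nonneg mult_nonneg_nonneg spectral_norm_nonneg) auto
    have \<sigma>: "0 < 2 * ?\<sigma> + 1"
      using spectral_norm_nonneg[of S] by simp
    have "0 < min (min \<delta>1 \<delta>2) (min (\<epsilon> / ?c) (1 / (2 * ?\<sigma> + 1)))"
      using \<open>0 < \<delta>1\<close> \<open>0 < \<delta>2\<close> \<open>0 < \<epsilon>\<close> \<open>0 < ?c\<close> \<sigma> by simp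
    then obtain t where "0 < t" "t < min (min \<delta>1 \<delta>2) (min (\<epsilon> / ?c) (1 / (2 * ?\<sigma> + 1)))"
      using dense by blast
    then have t: "0 < t" "t < \<delta>1" "t < \<delta>2" "t < \<epsilon> / ?c" "t < 1 / (2 * ?\<sigma> + 1)"
      unfolding min_less_iff_conj by blast+
    have "t * (2 * ?\<sigma> + 1) < 1"
      using t(5) \<sigma> by (simp only: pos_less_divide_eq)
    then have t\<sigma>: "t * ?\<sigma> \<le> 1 / 2"
      using t(1) by (simp add: algebra_simps)
    obtain B where B: "(mat 1 + t *\<^sub>R S) ** B = mat 1"
      using obtain_perturbed_inverse[OF t(1) t\<sigma>] .
    define X' where "X' = X ** (mat 1 + t *\<^sub>R S)"
    define Y' where "Y' = B ** Y"
    have XY': "X' ** Y' = M"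
      unfolding X'_def Y'_def M[symmetric] by (metis B matrix_mul_assoc matrix_mul_rid)
    have X': "X' = X + t *\<^sub>R (X ** S)"
      by (simp add: X'_def matrix_mult.add_right matrix_mult.scaleR_right)
    have "(mat 1 + t *\<^sub>R S) ** Y' = Y"
      unfolding Y'_def by (simp add: matrix_mul_assoc B)
    then have Y': "Y' = Y + t *\<^sub>R ((- S) ** Y')"
      by (simp add: matrix_mult.add_left matrix_mult.scaleR_left matrix_mult.minus_left algebra_simps)
    have "spectral_norm X' < s"
      using \<delta>1[OF t(1,2), of "transpose X'"]
      by (simp add: X' transpose_add transpose_scalar matrix_transpose_mul tS spectral_norm_transpose)
        (metis X' matrix_transpose_mul spectral_norm_transpose tS transpose_add transpose_scalar)
    moreover have "spectral_norm Y' < s"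
      using \<delta>2[OF t(1,3) Y'] .
    ultimately have "(spectral_norm X')\<^sup>2 + (spectral_norm Y')\<^sup>2 < s\<^sup>2 + s\<^sup>2"
      by (intro add_strict_mono power_strict_mono) (auto simp: spectral_norm_nonneg)
    moreover have "(X', Y') \<in> U"
    proof -
      have YY: "norm (Y' - Y) \<le> t * (?\<sigma> * norm Y')"
      proof -
        have "Y' - Y = t *\<^sub>R ((- S) ** Y')"
          using Y' by (simp add: algebra_simps)
        then have "norm (Y' - Y) = t * norm (S ** Y')"
          using t(1) by (simp add: matrix_mult.minus_left)
        also have "\<dots> \<le> t * (?\<sigma> * norm Y')"
          using t(1) by (intro mult_left_mono norm_matrix_mult_le_spectral_norm_left) simp
        finally show ?thesis .
      qed
      also have "\<dots> = t * ?\<sigma> * norm Y'" by simp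
      also have "\<dots> \<le> 1 / 2 * norm Y'"
        by (intro mult_right_mono t\<sigma>) simp
      finally have "norm Y' \<le> 2 * norm Y"
        using norm_triangle_sub[of Y' Y] by simp
      then have "t * (?\<sigma> * norm Y') \<le> t * (?\<sigma> * (2 * norm Y))"
        using t(1) by (intro mult_left_mono spectral_norm_nonneg) auto
      with YY have Yd: "norm (Y' - Y) \<le> t * (?\<sigma> * (2 * norm Y))" by simp
      have "dist (X, Y) (X', Y') \<le> norm (X' - X) + norm (Y' - Y)"
        unfolding dist_prod_def by (simp add: dist_norm norm_minus_commute sqrt_sum_squares_le_sum)
      also have "\<dots> \<le> t * norm (X ** S) + t * (?\<sigma> * (2 * norm Y))"
        using Yd t(1) by (simp add: X')
      also have "\<dots> < t * ?c"
        using t(1) by (simp add: algebra_simps)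
      also have "\<dots> < \<epsilon>"
        using t(4) \<open>0 < ?c\<close> by (simp only: pos_less_divide_eq)
      finally show ?thesis
        using \<epsilon> by auto
    qed
    ultimately show False
      using min[OF XY'] by simp
  qed
  then obtain w where w: "w \<noteq> 0" "transpose X *v (X *v w) = s\<^sup>2 *\<^sub>R w"
      "Y *v (transpose Y *v w) = s\<^sup>2 *\<^sub>R w"
    by blast
  have "(norm (X *v w))\<^sup>2 = (s * norm w)\<^sup>2"
  proof -
    have "(norm (X *v w))\<^sup>2 = w \<bullet> (transpose X *v (X *v w))"
      by (simp only: power2_norm_eq_inner inner_transpose_mult_vector)
    then show ?thesis
      by (simp add: w(2) power_mult_distrib power2_norm_eq_inner del: transpose_matrix_vector)
  qed
  then have Xw: "norm (X *v w) = s * norm w"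
    using \<open>0 < s\<close> by (simp add: power2_eq_iff_nonneg)
  \<comment> \<open>Y^T w has norm at most s |w|, but its image under M has norm s^3 |w|.\<close>
  have "M *v (transpose Y *v w) = s\<^sup>2 *\<^sub>R (X *v w)"
    by (simp add: M[symmetric] w(3) matrix_vector_mult_scaleR del: transpose_matrix_vector
        flip: matrix_vector_mul_assoc)
  then have "s\<^sup>2 * (s * norm w) = norm (M *v (transpose Y *v w))"
    by (simp add: Xw del: transpose_matrix_vector)
  also have "\<dots> \<le> spectral_norm M * (s * norm w)"
    using norm_mult_vector_le[of M "transpose Y *v w"] norm_mult_vector_le[of "transpose Y" w]
    by (simp add: spectral_norm_transpose s del: transpose_matrix_vector)
      (meson mult_left_mono order_trans spectral_norm_nonneg)
  finally have "s\<^sup>2 \<le> spectral_norm M"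
    using \<open>0 < s\<close> w(1) by simp
  moreover have "spectral_norm M \<le> s\<^sup>2"
    using spectral_norm_mult_le[of X Y] by (simp add: M s power2_eq_square)
  ultimately show ?thesis by simp
qed

text \<open>Rescaling to (t X, Y / t) keeps the product. With a and b the two spectral norms, t^2
  a^2 + b^2 / t^2 has derivative 2 a^2 - 2 b^2 at t = 1, which must vanish.\<close>

lemma spectral_norm_eq_of_local_min:
  fixes X :: "real^'r^'m" and Y :: "real^'n^'r"
  assumes M: "X ** Y = M" and U: "open U" "(X, Y) \<in> U"
    and min: "\<And>X' Y'. X' ** Y' = M \<Longrightarrow> (X', Y') \<in> U \<Longrightarrow>
      (spectral_norm X)\<^sup>2 + (spectral_norm Y)\<^sup>2 \<le> (spectral_norm X')\<^sup>2 + (spectral_norm Y')\<^sup>2"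
  shows "spectral_norm X = spectral_norm Y"
proof -
  let ?a = "spectral_norm X" and ?b = "spectral_norm Y"
  let ?p = "\<lambda>t. (t *\<^sub>R X, (1 / t) *\<^sub>R Y)"
  let ?g = "\<lambda>t::real. t\<^sup>2 * ?a\<^sup>2 + (1 / t)\<^sup>2 * ?b\<^sup>2"
  have "(?p \<longlongrightarrow> ?p 1) (at 1)"
    by (intro tendsto_intros) auto
  then have "\<forall>\<^sub>F t in at 1. ?p t \<in> U"
    using U by (intro topological_tendstoD) auto
  then obtain d where "0 < d" and d: "\<And>t. t \<noteq> 1 \<Longrightarrow> dist t 1 < d \<Longrightarrow> ?p t \<in> U"
    by (auto simp: eventually_at)
  have "DERIV ?g 1 :> 2 * ?a\<^sup>2 - 2 * ?b\<^sup>2"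
    by (auto intro!: derivative_eq_intros)
  then have "2 * ?a\<^sup>2 - 2 * ?b\<^sup>2 = 0"
  proof (rule DERIV_local_min)
    \<comment> \<open>The cap 1 on the radius keeps t positive.\<close>
    show "0 < min d 1" using \<open>0 < d\<close> by simp
    show "\<forall>t. \<bar>1 - t\<bar> < min d 1 \<longrightarrow> ?g 1 \<le> ?g t"
    proof (intro allI impI)
      fix t :: real assume t: "\<bar>1 - t\<bar> < min d 1"
      then have "0 < t" by (auto simp: min_def split: if_splits)
      have "?p t \<in> U"
        using d[of t] t U by (cases "t = 1") (auto simp: dist_norm abs_minus_commute)
      moreover have "(t *\<^sub>R X) ** ((1 / t) *\<^sub>R Y) = M"
        using \<open>0 < t\<close> M by (simp add: matrix_mult.scaleR_left matrix_mult.scaleR_right)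
      ultimately show "?g 1 \<le> ?g t"
        using min[of "t *\<^sub>R X" "(1 / t) *\<^sub>R Y"] by (simp add: spectral_norm_scaleR power_mult_distrib power_divide)
    qed
  qed
  then show ?thesis
    by (simp add: power2_eq_iff_nonneg spectral_norm_nonneg)
qed

subsection \<open>Optimal factorizations\<close>

lemma spectral_norm_factorization_le:
  fixes X :: "real^'r^'m" and Y :: "real^'n^'r"
  assumes "X ** Y = M"
  shows "2 * spectral_norm M \<le> (spectral_norm X)\<^sup>2 + (spectral_norm Y)\<^sup>2"
  using spectral_norm_mult_le[of X Y] sum_squares_bound[of "spectral_norm X" "spectral_norm Y"] assms
  by simp

text \<open>Let a and b be the norms of X and Y. As |M| \<le> a b, equality forces (a - b)^2 = 2 |M|
  - 2 a b \<le> 0.\<close>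

lemma spectral_norm_factorization_eq_iff:
  fixes X :: "real^'r^'m" and Y :: "real^'n^'r"
  assumes "X ** Y = M"
  shows "(spectral_norm X)\<^sup>2 + (spectral_norm Y)\<^sup>2 = 2 * spectral_norm M \<longleftrightarrow>
    spectral_norm X = spectral_norm Y \<and> spectral_norm Y = sqrt (spectral_norm M)"
proof
  let ?a = "spectral_norm X" and ?b = "spectral_norm Y"
  assume eq: "?a\<^sup>2 + ?b\<^sup>2 = 2 * spectral_norm M"
  have "(?a - ?b)\<^sup>2 = ?a\<^sup>2 + ?b\<^sup>2 - 2 * (?a * ?b)"
    by (simp add: power2_diff)
  also have "\<dots> \<le> 0"
    using spectral_norm_mult_le[of X Y] assms by (simp add: eq)
  finally have "?a = ?b" by simp
  moreover from this have "?b\<^sup>2 = spectral_norm M"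
    using eq by simp
  ultimately show "?a = ?b \<and> ?b = sqrt (spectral_norm M)"
    using spectral_norm_nonneg[of Y] by (auto simp: real_sqrt_unique)
qed (simp add: spectral_norm_nonneg)

text \<open>With \<open>Z = X K + H Y\<close>, at least half of \<open>\<parallel>Z\<parallel>\<^sub>F\<^sup>2\<close> comes from \<open>X K\<close>, and the balance condition turns
  \<open>Z M\<^sup>T = 2 s\<^sup>2 H X\<^sup>T\<close> into a matrix of norm \<open>2 s\<^sup>2 \<parallel>X K\<parallel>\<^sub>F \<ge> s\<^sup>2 \<parallel>Z\<parallel>\<^sub>F\<close>.\<close>

lemma spectral_norm_of_balanced_eigenpair:
  fixes X :: "real^'r^'m" and Y :: "real^'n^'r"
  assumes M: "X ** Y = M" and s: "spectral_norm X = s" "spectral_norm Y = s"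
    and nz: "(H, K) \<noteq> 0"
    and H: "(X ** K + H ** Y) ** transpose Y = (s\<^sup>2 + s\<^sup>2) *\<^sub>R H"
    and K: "transpose X ** (X ** K + H ** Y) = (s\<^sup>2 + s\<^sup>2) *\<^sub>R K"
    and HK: "transpose H ** H = K ** transpose K"
  shows "spectral_norm M = s\<^sup>2"
proof (cases "s = 0")
  case True
  with s have "X = 0" by (simp add: spectral_norm_eq_0)
  with M True show ?thesis by (auto simp: spectral_norm_eq_0)
next
  case False
  then have "0 < s"
    using spectral_norm_nonneg[of X] s by simp
  define Z where "Z = X ** K + H ** Y"
  have ZH: "Z ** transpose Y = (2 * s\<^sup>2) *\<^sub>R H" and ZK: "transpose X ** Z = (2 * s\<^sup>2) *\<^sub>R K"
    using H K by (simp_all add: Z_def)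
  have "Z \<noteq> 0"
    using ZH ZK nz \<open>0 < s\<close> by (auto simp: zero_prod_def)
  \<comment> \<open>H Y contributes at most half of |Z|^2, because 2 s^2 (H Y . Z) = |Z Y^T|^2 \<le>
    s^2 |Z|^2.\<close>
  have "(2 * s\<^sup>2) * ((H ** Y) \<bullet> Z) = (norm (Z ** transpose Y))\<^sup>2"
    using inner_matrix_mult_right[of H Y Z] unfolding power2_norm_eq_inner by (simp add: ZH)
  also have "\<dots> \<le> (norm Z * s)\<^sup>2"
    using norm_matrix_mult_le_spectral_norm_right[of Z "transpose Y"]
    by (intro power_mono) (auto simp: spectral_norm_transpose s)
  also have "\<dots> = s\<^sup>2 * ((X ** K) \<bullet> Z + (H ** Y) \<bullet> Z)"
    by (simp add: power_mult_distrib power2_norm_eq_inner flip: inner_add_left Z_def)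
  finally have "s\<^sup>2 * ((H ** Y) \<bullet> Z) \<le> s\<^sup>2 * ((X ** K) \<bullet> Z)"
    by (simp add: algebra_simps)
  then have "(H ** Y) \<bullet> Z \<le> (X ** K) \<bullet> Z"
    using \<open>0 < s\<close> by simp
  moreover have "(X ** K) \<bullet> Z + (H ** Y) \<bullet> Z = norm Z * norm Z"
    by (simp add: power2_norm_eq_inner flip: inner_add_left Z_def power2_eq_square)
  moreover have "(X ** K) \<bullet> Z \<le> norm (X ** K) * norm Z"
    by (rule norm_cauchy_schwarz)
  ultimately have "norm Z * norm Z \<le> (2 * norm (X ** K)) * norm Z"
    by simp
  then have XK: "norm Z \<le> 2 * norm (X ** K)"
    using \<open>Z \<noteq> 0\<close> by simp
  \<comment> \<open>|H X^T| depends on H only through H^T H, which may be replaced by K K^T.\<close>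
  have "(norm (H ** transpose X))\<^sup>2 = transpose X \<bullet> ((transpose H ** H) ** transpose X)"
    by (simp add: power2_norm_eq_inner inner_matrix_mult_left matrix_mul_assoc)
  also have "\<dots> = (norm (transpose K ** transpose X))\<^sup>2"
    unfolding HK using inner_matrix_mult_left[of "transpose K" "transpose X" "transpose K ** transpose X"]
    by (simp add: power2_norm_eq_inner matrix_mul_assoc)
  also have "transpose K ** transpose X = transpose (X ** K)"
    by (simp add: matrix_transpose_mul)
  finally have HX: "norm (H ** transpose X) = norm (X ** K)"
    by (simp add: norm_transpose power2_eq_iff_nonneg)
  have "Z ** transpose M = (2 * s\<^sup>2) *\<^sub>R (H ** transpose X)"
    by (simp add: M[symmetric] matrix_transpose_mul matrix_mul_assoc ZH matrix_mult.scaleR_left)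
  then have "norm (Z ** transpose M) = s\<^sup>2 * (2 * norm (X ** K))"
    by (simp add: HX)
  then have "s\<^sup>2 * norm Z \<le> norm (Z ** transpose M)"
    using XK by (simp add: mult_left_mono)
  also have "\<dots> \<le> norm Z * spectral_norm M"
    using norm_matrix_mult_le_spectral_norm_right[of Z "transpose M"]
    by (simp add: spectral_norm_transpose)
  finally have "s\<^sup>2 \<le> spectral_norm M"
    using \<open>Z \<noteq> 0\<close> by (simp add: mult.commute)
  moreover have "spectral_norm M \<le> s\<^sup>2"
    using spectral_norm_mult_le[of X Y] by (simp add: M s power2_eq_square)
  ultimately show ?thesis by simp
qed

text \<open>The implications run (i), (ii), (iii), (vii), (i) in a cycle; (vii) is also equivalent
  to (iv) and to (vi), and implies (v), which implies (iii).\<close>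

theorem proposition4p26:
  fixes M :: "real^'n^'m" and X :: "real^'r^'m" and Y :: "real^'n^'r"
    and f :: "(real^'r^'m) \<times> (real^'n^'r) \<Rightarrow> real"
  defines "f \<equiv> factorization_loss M"
  assumes "X ** Y = M"
  shows
    "(globally_flat f (X, Y) \<longleftrightarrow> flat f (X, Y)) \<and>
     (globally_flat f (X, Y) \<longleftrightarrow>
        local_min_on (\<lambda>p. largest_eigenvalue (hessian f p)) (factorizations M) (X, Y)) \<and>
     (globally_flat f (X, Y) \<longleftrightarrow>
        spectral_norm X = spectral_norm Y \<and>
        (\<exists>H K. (H, K) \<in> top_eigenspace (hessian f (X, Y)) - {0} \<and>
               transpose H ** H = K ** transpose K)) \<and>
     (globally_flat f (X, Y) \<longleftrightarrow>
        global_min_on (\<lambda>p. largest_eigenvalue (hessian f p)) (factorizations M) (X, Y)) \<and>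
     (globally_flat f (X, Y) \<longleftrightarrow>
        (spectral_norm X)\<^sup>2 + (spectral_norm Y)\<^sup>2 = 2 * spectral_norm M) \<and>
     (globally_flat f (X, Y) \<longleftrightarrow>
        spectral_norm X = spectral_norm Y \<and> spectral_norm Y = sqrt (spectral_norm M))"
proof -
  let ?P = "factorizations M :: ((real^'r^'m) \<times> (real^'n^'r)) set"
  let ?g = "\<lambda>p. largest_eigenvalue (hessian f p)"
  let ?l = "\<lambda>X Y. (spectral_norm (X :: real^'r^'m))\<^sup>2 + (spectral_norm (Y :: real^'n^'r))\<^sup>2"
  let ?iii = "local_min_on ?g ?P (X, Y)"
  let ?iv = "spectral_norm X = spectral_norm Y \<and>
    (\<exists>H K. (H, K) \<in> top_eigenspace (hessian f (X, Y)) - {0} \<and>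
      transpose H ** H = K ** transpose K)"
  let ?vii = "spectral_norm X = spectral_norm Y \<and> spectral_norm Y = sqrt (spectral_norm M)"
  note f = f_def
  have g: "?g (X', Y') = ?l X' Y'" if "X' ** Y' = M" for X' Y'
    unfolding f using that by (rule largest_eigenvalue_hessian)
  \<comment> \<open>The loss is 0 exactly at the factorizations of M.\<close>
  have level: "level_set f (X, Y) = ?P"
    using \<open>X ** Y = M\<close> by (auto simp: level_set_def factorizations_def f factorization_loss_def)
  have XY: "(X, Y) \<in> ?P"
    using \<open>X ** Y = M\<close> by (simp add: factorizations_def)
  have vi: "?l X Y = 2 * spectral_norm M \<longleftrightarrow> ?vii"
    using \<open>X ** Y = M\<close> by (rule spectral_norm_factorization_eq_iff)
  have "globally_flat f (X, Y) \<Longrightarrow> flat f (X, Y)"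
    unfolding globally_flat_def flat_def
    by (rule exI[of _ "level_set f (X, Y)"]) (auto simp: level_set_def)
  moreover have "?iii" if flat: "flat f (X, Y)"
  proof -
    obtain U where U: "openin (top_of_set ?P) U" "(X, Y) \<in> U"
      and fl: "\<forall>y\<in>U - {(X, Y)}. flatter_eq f (X, Y) y"
      using flat unfolding flat_def level by blast
    then obtain V where V: "open V" "U = ?P \<inter> V"
      by (auto simp: openin_open)
    have "?g (X, Y) \<le> ?g y" if "y \<in> ?P \<inter> V" for y
    proof (cases "y = (X, Y)")
      case False
      obtain X' Y' where y: "y = (X', Y')" by (cases y)
      have "X' ** Y' = M"
        using that by (simp add: y factorizations_def)
      moreover have "flatter_eq f (X, Y) (X', Y')"
        using fl that False V y by auto
      ultimately show ?thesis
        using flatter_eq_imp_le[OF \<open>X ** Y = M\<close>] g \<open>X ** Y = M\<close> by (simp add: y f)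
    qed simp
    then show ?thesis
      unfolding local_min_on_def is_arg_min_def
      using V U XY by (intro exI[of _ V]) (auto simp: not_less)
  qed
  moreover have "?vii" if iii: "?iii"
  proof -
    obtain U where U: "open U" "(X, Y) \<in> U"
      and min: "\<And>y. y \<in> ?P \<inter> U \<Longrightarrow> ?g (X, Y) \<le> ?g y"
      using iii unfolding local_min_on_def is_arg_min_def by (auto simp: not_less)
    have min': "?l X Y \<le> ?l X' Y'" if "X' ** Y' = M" "(X', Y') \<in> U" for X' Y'
      using min[of "(X', Y')"] that g \<open>X ** Y = M\<close> by (simp add: factorizations_def)
    have eq: "spectral_norm X = spectral_norm Y"
      using \<open>X ** Y = M\<close> U min' by (rule spectral_norm_eq_of_local_min)
    then have "spectral_norm M = (spectral_norm Y)\<^sup>2"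
      using balanced_of_local_min[OF \<open>X ** Y = M\<close> U eq refl] min' by simp
    with eq show ?thesis
      by (simp add: spectral_norm_nonneg)
  qed
  moreover have "globally_flat f (X, Y)" if "?vii"
    unfolding globally_flat_def level
  proof
    fix p assume "p \<in> ?P"
    then obtain X' Y' where p: "p = (X', Y')" and M': "X' ** Y' = M"
      by (auto simp: factorizations_def)
    define l where "l = sqrt (?l X Y)"
    define l' where "l' = sqrt (?l X' Y')"
    have up: "max_variation f (X, Y) \<rho> \<le> ereal ((l * \<rho> + \<rho>\<^sup>2 / 2)\<^sup>2 / 2)" for \<rho>
      using max_variation_loss_upper[OF \<open>X ** Y = M\<close>] by (simp add: f l_def)
    have "?l X Y \<le> ?l X' Y'"
      using that vi spectral_norm_factorization_le[OF M'] by simp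
    then consider "?l X Y = ?l X' Y'" | "?l X Y < ?l X' Y'"
      by linarith
    then show "flatter_eq f (X, Y) p"
    proof cases
      \<comment> \<open>In a tie the other factorization is optimal as well, so it attains the upper
        bound that both share.\<close>
      case 1
      have "?l X' Y' = 2 * spectral_norm M"
        using that vi 1 by metis
      then have vii': "spectral_norm X' = spectral_norm Y'" "spectral_norm Y' = sqrt (spectral_norm M)"
        using spectral_norm_factorization_eq_iff[OF M'] by blast+
      have M2: "spectral_norm M = (spectral_norm Y')\<^sup>2"
        by (simp add: vii'(2) spectral_norm_nonneg)
      have "ereal ((l * \<rho> + \<rho>\<^sup>2 / 2)\<^sup>2 / 2) \<le> max_variation f (X', Y') \<rho>" if "0 \<le> \<rho>" for \<rho>
        using max_variation_loss_balanced[OF M' vii'(1) refl M2 that] unfolding l_def f 1 vii'(1) .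
      then have "max_variation f (X, Y) \<rho> \<le> max_variation f (X', Y') \<rho>" if "0 \<le> \<rho>" for \<rho>
        using order_trans[OF up] that by blast
      then show ?thesis
        unfolding flatter_eq_def p by (intro exI[of _ 1]) auto
    next
      \<comment> \<open>For \<rho> \<le> l' - l the upper bound at (X, Y) does not exceed the lower
        bound at (X', Y').\<close>
      case 2
      then have l: "0 \<le> l" "l < l'"
        by (simp_all add: l_def l'_def)
      have "max_variation f (X, Y) \<rho> \<le> max_variation f (X', Y') \<rho>" if \<rho>: "0 < \<rho>" "\<rho> \<le> l' - l" for \<rho>
      proof -
        have "(l + \<rho>) * \<rho> \<le> l' * \<rho>"
          using \<rho> by (intro mult_right_mono) auto
        then have "l * \<rho> + \<rho>\<^sup>2 / 2 \<le> l' * \<rho> - \<rho>\<^sup>2 / 2"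
          by (simp add: algebra_simps power2_eq_square)
        then have "ereal ((l * \<rho> + \<rho>\<^sup>2 / 2)\<^sup>2 / 2) \<le> ereal ((l' * \<rho> - \<rho>\<^sup>2 / 2)\<^sup>2 / 2)"
          using \<rho> l by (simp add: power_mono)
        also have "\<dots> \<le> max_variation f (X', Y') \<rho>"
          using max_variation_loss_lower[OF M', of \<rho>] \<rho> l unfolding f l'_def[symmetric] by simp
        finally show ?thesis
          using up order_trans by blast
      qed
      then show ?thesis
        unfolding flatter_eq_def p using l by (intro exI[of _ "l' - l"]) auto
    qed
  qed
  moreover have "?vii" if iv: "?iv"
  proof -
    obtain H K where HK: "(H, K) \<in> top_eigenspace (hessian f (X, Y)) - {0}"
        "transpose H ** H = K ** transpose K"
      using iv by blast
    then have nz: "(H, K) \<noteq> 0" and eig: "hessian f (X, Y) (H, K) = ?l X Y *\<^sub>R (H, K)"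
      using g[OF \<open>X ** Y = M\<close>] by (simp_all add: top_eigenspace_def)
    have eq: "spectral_norm X = spectral_norm Y"
      using iv by simp
    have "spectral_norm M = (spectral_norm Y)\<^sup>2"
      using spectral_norm_of_balanced_eigenpair[OF \<open>X ** Y = M\<close> eq refl nz _ _ HK(2)] eig eq
      by (simp add: f hessian_factorization_loss[OF \<open>X ** Y = M\<close>])
    with eq show ?thesis
      by (simp add: spectral_norm_nonneg)
  qed
  moreover have "?iv" if "?vii"
  proof -
    define s where "s = spectral_norm Y"
    have s: "spectral_norm X = s" "spectral_norm Y = s" "spectral_norm M = s\<^sup>2"
      using that by (simp_all add: s_def spectral_norm_nonneg)
    obtain Z H K where Z: "norm H = 1" "X ** K = s *\<^sub>R Z" "H ** Y = s *\<^sub>R Z"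
        "Z ** transpose Y = s *\<^sub>R H" "transpose X ** Z = s *\<^sub>R K"
        "transpose H ** H = K ** transpose K"
      by (rule balanced_top_singular_matrices[OF \<open>X ** Y = M\<close> s])
    have "X ** K + H ** Y = (s + s) *\<^sub>R Z"
      by (simp only: Z scaleR_left_distrib)
    then have "hessian f (X, Y) (H, K) = (s\<^sup>2 + s\<^sup>2) *\<^sub>R (H, K)"
      by (simp add: f hessian_factorization_loss[OF \<open>X ** Y = M\<close>] Z(4,5)
          matrix_mult.scaleR_left matrix_mult.scaleR_right power2_eq_square)
    then have "(H, K) \<in> top_eigenspace (hessian f (X, Y))"
      by (simp add: top_eigenspace_def g[OF \<open>X ** Y = M\<close>] s)
    moreover have "(H, K) \<noteq> 0"
      using Z(1) by (auto simp: zero_prod_def)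
    ultimately show ?thesis
      using Z(6) that by blast
  qed
  moreover have "global_min_on ?g ?P (X, Y)" if "?vii"
    unfolding global_min_on_def is_arg_min_def
  proof (intro conjI XY notI)
    assume "\<exists>y. y \<in> ?P \<and> ?g y < ?g (X, Y)"
    then obtain X' Y' where "X' ** Y' = M" "?g (X', Y') < ?g (X, Y)"
      by (auto simp: factorizations_def)
    then show False
      using spectral_norm_factorization_le[of X' Y' M] g \<open>X ** Y = M\<close> that vi by simp
  qed
  moreover have "?iii" if "global_min_on ?g ?P (X, Y)"
    using that unfolding local_min_on_def global_min_on_def by (intro exI[of _ UNIV]) simp
  ultimately show ?thesis
    using vi by blast
qed

end
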